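(* Let $G$ be a solid branchwise implicative weak BCC-algebra. Then for all $x,y\in G$ belonging to the same branch, $$(xy)(0y)=\big(((xy)(0y))\,y\big)(0y).$$
   Context: The operation is written by juxtaposition. A weak BCC-algebra is a set $G$ with a binary operation and a constant $0$ such that for all $x,y,z\in G$: $((xy)(zy))(xz)=0$; $xx=0$; $x0=x$; and $xy=yx=0$ implies $x=y$. Its natural partial order is $x\leqslant y\iff xy=0$. $I(G)$ denotes the set of minimal elements of $(G,\leqslant)$; for $a\in I(G)$ the branch initiated by $a$ is $B(a)=\{x\in G: a\leqslant x\}$. Elements $x,y$ are in the same branch if $x,y\in B(a)$ for some $a\in I(G)$. $G$ is solid if $(xy)z=(xz)y$ for all $x,y$ belonging to the same branch and all $z\in G$. $G$ is branchwise implicative if $x(yx)=x$ for all $x,y$ belonging to the same branch. *)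

theory Defs
  imports Main
begin

locale weak_BCC_algebra =
  fixes G :: "'a set"
    and mult :: "'a \<Rightarrow> 'a \<Rightarrow> 'a" (infixl "\<cdot>" 70)
    and zero :: "'a" ("\<zero>")
  assumes mult_closed: "x \<in> G \<Longrightarrow> y \<in> G \<Longrightarrow> x \<cdot> y \<in> G"
    and zero_closed: "\<zero> \<in> G"
    and BCC: "x \<in> G \<Longrightarrow> y \<in> G \<Longrightarrow> z \<in> G \<Longrightarrow> ((x \<cdot> y) \<cdot> (z \<cdot> y)) \<cdot> (x \<cdot> z) = \<zero>"
    and mult_self: "x \<in> G \<Longrightarrow> x \<cdot> x = \<zero>"
    and mult_zero: "x \<in> G \<Longrightarrow> x \<cdot> \<zero> = x"
    and mult_antisym: "x \<in> G \<Longrightarrow> y \<in> G \<Longrightarrow> x \<cdot> y = \<zero> \<Longrightarrow> y \<cdot> x = \<zero> \<Longrightarrow> x = y"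
begin

definition le :: "'a \<Rightarrow> 'a \<Rightarrow> bool" (infix "\<preceq>" 50)
  where "x \<preceq> y \<longleftrightarrow> x \<cdot> y = \<zero>"

definition minimal_elements :: "'a set"
  where "minimal_elements = {a \<in> G. \<forall>x\<in>G. x \<preceq> a \<longrightarrow> x = a}"

definition branch :: "'a \<Rightarrow> 'a set"
  where "branch a = {x \<in> G. a \<preceq> x}"

definition same_branch :: "'a \<Rightarrow> 'a \<Rightarrow> bool"
  where "same_branch x y \<longleftrightarrow> (\<exists>a\<in>minimal_elements. x \<in> branch a \<and> y \<in> branch a)"

end

locale solid_weak_BCC_algebra = weak_BCC_algebra +
  assumes solid: "same_branch x y \<Longrightarrow> z \<in> G \<Longrightarrow> (x \<cdot> y) \<cdot> z = (x \<cdot> z) \<cdot> y"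

locale branchwise_implicative_weak_BCC_algebra = weak_BCC_algebra +
  assumes branchwise_implicative: "same_branch x y \<Longrightarrow> x \<cdot> (y \<cdot> x) = x"

end

theory Submission
  imports Defs
begin

text \<open>
  Let \<open>a\<close> be the minimal element below \<open>x\<close> and \<open>y\<close>. The expression
  \<open>(x \<cdot> y) \<cdot> (\<zero> \<cdot> y)\<close> is the difference \<open>x \<cdot> y\<close>, which lies in the branch of \<open>\<zero>\<close>,
  moved back to the branch of \<open>a\<close> (lemma \<open>translated_difference_above\<close>); it always lies below
  \<open>x\<close> (lemma \<open>translated_difference_le\<close>). The identity says that the map
  \<open>x \<mapsto> (x \<cdot> y) \<cdot> (\<zero> \<cdot> y)\<close> is idempotent on the branch of \<open>a\<close>.

  Let \<open>w\<close> be the image of \<open>x\<close> and \<open>v\<close> that of \<open>w\<close>. Then \<open>v \<preceq> w\<close>, and it remains to see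
  that the defect \<open>t = w \<cdot> v\<close> vanishes. Two applications of the BCC axiom give \<open>t \<preceq> x \<cdot> w\<close>.
  Implicativity makes \<open>w\<close> disjoint from \<open>x \<cdot> w\<close>, that is \<open>w \<cdot> (x \<cdot> w) = w\<close>, so
  \<open>w \<cdot> t = w\<close> as well. On the other hand \<open>t \<preceq> w \<cdot> a\<close>. An element of the branch of \<open>\<zero>\<close>
  with these two properties is \<open>\<zero>\<close>, by solidity and implicativity (lemma \<open>zero_if_disjoint\<close>).
\<close>

context weak_BCC_algebra
begin

lemma left_mono:
  assumes "x \<in> G" "y \<in> G" "z \<in> G" "x \<preceq> y"
  shows "x \<cdot> z \<preceq> y \<cdot> z"
  using BCC[of x z y] assms by (simp add: le_def mult_closed mult_zero)

lemma right_antimono: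
  assumes "x \<in> G" "y \<in> G" "z \<in> G" "x \<preceq> y"
  shows "z \<cdot> y \<preceq> z \<cdot> x"
  using BCC[of z y x] assms by (simp add: le_def mult_closed mult_zero)

lemma le_trans:
  assumes "x \<in> G" "y \<in> G" "z \<in> G" "x \<preceq> y" "y \<preceq> z"
  shows "x \<preceq> z"
  using left_mono[of x y z] assms by (simp add: le_def mult_closed mult_zero)

lemma zero_minimal: "\<zero> \<in> minimal_elements"
  by (auto simp: minimal_elements_def le_def zero_closed mult_zero)

lemma same_branchI:
  assumes "a \<in> minimal_elements" "x \<in> G" "y \<in> G" "a \<preceq> x" "a \<preceq> y"
  shows "same_branch x y"
  using assms by (auto simp: same_branch_def branch_def)

lemma zero_le_difference:
  assumes "a \<in> G" "x \<in> G" "y \<in> G" "a \<preceq> x" "a \<preceq> y"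
  shows "\<zero> \<preceq> x \<cdot> y"
  using left_mono[of a x y] assms by (simp add: le_def)

lemma difference_le:
  assumes "x \<in> G" "t \<in> G" "\<zero> \<preceq> t"
  shows "x \<cdot> t \<preceq> x"
  using right_antimono[of \<zero> t x] assms by (simp add: zero_closed mult_zero)

lemma translated_difference_le:
  assumes "x \<in> G" "y \<in> G"
  shows "(x \<cdot> y) \<cdot> (\<zero> \<cdot> y) \<preceq> x"
  using BCC[of x y \<zero>] assms by (simp add: le_def zero_closed mult_zero)

lemma translated_difference_above:
  assumes a: "a \<in> minimal_elements" and x: "x \<in> G" and y: "y \<in> G"
    and ax: "a \<preceq> x" and ay: "a \<preceq> y"
  shows "a \<preceq> (x \<cdot> y) \<cdot> (\<zero> \<cdot> y)"
proof -
  have aG: "a \<in> G" using a by (simp add: minimal_elements_def)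
  \<comment> \<open>Since \<open>a \<cdot> y = \<zero>\<close>, the element \<open>\<zero> \<cdot> (\<zero> \<cdot> y)\<close> lies below \<open>a\<close>, hence equals \<open>a\<close>.\<close>
  have "\<zero> \<cdot> (\<zero> \<cdot> y) \<preceq> a"
    using translated_difference_le[of a y] aG y ay by (simp add: le_def)
  then have "\<zero> \<cdot> (\<zero> \<cdot> y) = a"
    using a y by (simp add: minimal_elements_def mult_closed zero_closed)
  then show ?thesis
    using left_mono[of \<zero> "x \<cdot> y" "\<zero> \<cdot> y"] zero_le_difference[OF aG x y ax ay] x y
    by (simp add: mult_closed zero_closed)
qed

end

locale solid_implicative_weak_BCC_algebra =
  solid_weak_BCC_algebra + branchwise_implicative_weak_BCC_algebra
begin

text \<open>
  An element \<open>t\<close> of the branch of \<open>\<zero>\<close> that is contained in \<open>w \<cdot> a\<close> and disjoint from \<open>w\<close>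
  vanishes. Disjointness passes from \<open>w\<close> to \<open>w \<cdot> a\<close> by solidity, which brings both
  hypotheses into the branch of \<open>\<zero>\<close>, where implicativity applies.
\<close>

lemma zero_if_disjoint:
  assumes a: "a \<in> minimal_elements" and w: "w \<in> G" and t: "t \<in> G"
    and aw: "a \<preceq> w" and t0: "\<zero> \<preceq> t"
    and below: "t \<preceq> w \<cdot> a" and disjoint: "w \<cdot> t = w"
  shows "t = \<zero>"
proof -
  have aG: "a \<in> G" using a by (simp add: minimal_elements_def)
  have aa: "a \<preceq> a" using aG by (simp add: le_def mult_self)
  have "same_branch w a" by (rule same_branchI[OF a w aG aw aa])
  then have "(w \<cdot> a) \<cdot> t = w \<cdot> a" using solid[of w a t] t disjoint by simp
  moreover have "same_branch t (w \<cdot> a)"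
    using same_branchI[OF zero_minimal t _ t0] zero_le_difference[OF aG w aG aw aa] w aG
    by (simp add: mult_closed)
  ultimately have "t \<cdot> (w \<cdot> a) = t" using branchwise_implicative[of t "w \<cdot> a"] by simp
  then show ?thesis using below by (simp add: le_def)
qed

lemma translated_difference_idem:
  assumes "same_branch x y"
  shows "(x \<cdot> y) \<cdot> (\<zero> \<cdot> y) = (((x \<cdot> y) \<cdot> (\<zero> \<cdot> y)) \<cdot> y) \<cdot> (\<zero> \<cdot> y)"
proof -
  obtain a where a: "a \<in> minimal_elements" and x: "x \<in> G" and y: "y \<in> G"
    and ax: "a \<preceq> x" and ay: "a \<preceq> y"
    using assms by (auto simp: same_branch_def branch_def)
  have aG: "a \<in> G" using a by (simp add: minimal_elements_def)
  define w where "w = (x \<cdot> y) \<cdot> (\<zero> \<cdot> y)"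
  define v where "v = (w \<cdot> y) \<cdot> (\<zero> \<cdot> y)"
  define t where "t = w \<cdot> v"
  have w: "w \<in> G" and v: "v \<in> G" and t: "t \<in> G"
    using x y by (simp_all add: w_def v_def t_def mult_closed zero_closed)
  have aw: "a \<preceq> w"
    unfolding w_def by (rule translated_difference_above[OF a x y ax ay])
  have av: "a \<preceq> v"
    unfolding v_def by (rule translated_difference_above[OF a w y aw ay])
  have vw: "v \<preceq> w" unfolding v_def by (rule translated_difference_le[OF w y])
  have t0: "\<zero> \<preceq> t"
    unfolding t_def by (rule zero_le_difference[OF aG w v aw av])
  have "t \<preceq> (x \<cdot> y) \<cdot> (w \<cdot> y)"
    using BCC[of "x \<cdot> y" "\<zero> \<cdot> y" "w \<cdot> y"] x y w
    by (simp add: le_def t_def v_def mult_closed zero_closed flip: w_def)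
  moreover have "(x \<cdot> y) \<cdot> (w \<cdot> y) \<preceq> x \<cdot> w"
    using BCC[of x y w] x y w by (simp add: le_def)
  ultimately have t_le: "t \<preceq> x \<cdot> w"
    using le_trans t x y w by (meson mult_closed)
  have "w \<cdot> (x \<cdot> w) = w"
    by (rule branchwise_implicative[OF same_branchI[OF a w x aw ax]])
  then have "w \<preceq> w \<cdot> t"
    using right_antimono[of t "x \<cdot> w" w] t_le t x w by (simp add: mult_closed)
  then have "w \<cdot> t = w"
    using mult_antisym difference_le[OF w t t0] w t by (simp add: le_def mult_closed)
  moreover have "t \<preceq> w \<cdot> a"
    unfolding t_def by (rule right_antimono[OF aG v w av])
  ultimately have "t = \<zero>" using zero_if_disjoint[OF a w t aw t0] by simp
  then have "w = v" using mult_antisym[OF w v] vw by (simp add: t_def le_def)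
  then show ?thesis by (simp add: w_def v_def)
qed

end

theorem theorem5p3:
  fixes G :: "'a set"
    and mult :: "'a \<Rightarrow> 'a \<Rightarrow> 'a" (infixl "\<cdot>" 70)
    and zero :: "'a" ("\<zero>")
  assumes "solid_weak_BCC_algebra G (\<cdot>) \<zero>"
    and "branchwise_implicative_weak_BCC_algebra G (\<cdot>) \<zero>"
    and "x \<in> G" and "y \<in> G"
    and "weak_BCC_algebra.same_branch G (\<cdot>) \<zero> x y"
  shows "(x \<cdot> y) \<cdot> (\<zero> \<cdot> y) = (((x \<cdot> y) \<cdot> (\<zero> \<cdot> y)) \<cdot> y) \<cdot> (\<zero> \<cdot> y)"
proof -
  interpret solid_implicative_weak_BCC_algebra G "(\<cdot>)" \<zero>
    using assms(1,2) by (rule solid_implicative_weak_BCC_algebra.intro)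
  show ?thesis by (rule translated_difference_idem[OF assms(5)])
qed

end
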